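(* Let $\ast\in\{R,L\}$, and let $\hat c_n$ be the risk-based empirical Bayes estimator if $\ast=R$ and the likelihood-based one if $\ast=L$. Write $D_{i,n}=D_{i,n}^\ast$, $R_{i,n}=R_{i,n}^\ast$ and $D_n=D_{1,n}+D_{2,n}$. Let $f$ be a function for which $$\sup_{c\in I_n}\frac{|R_{1,n}(c,f)|+|R_{2,n}(c)|}{D_n(c,f)}\to0\quad\text{in } P_f\text{-probability}.$$ Then for any $\varepsilon>0$ $$P_f\Bigl(D_n(\hat c_n,f)\le(1+\varepsilon)\inf_{c\in I_n}D_n(c,f)\Bigr)\to1 .$$ Furthermore, if $f$ satisfies the good bias condition relative to $D_{1,n}$ with constant $a$, the $D_{2,n}$ are good variance functions with constants $b,B,B'$, and $\sum_{j=1}^nf_{j,n}^2\le\sup_{c\in I_n}D_{2,n}(c)$, then also $$P_f\Bigl(D_{1,n}(\hat c_n,f)\le B^{-1}(2+2\varepsilon)^{1+b/a}D_{2,n}(\hat c_n)\Bigr)\to1 .$$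
   Context: Setting. $\mathcal X$ is a set and for each $n$, $x_{1,n},\dots,x_{n,n}\in\mathcal X$ are known design points. For $f:\mathcal X\to\mathbb R$ write $\vec f_n=(f(x_{1,n}),\dots,f(x_{n,n}))^T$. Under $P_f$ one observes $\vec Y_n=\vec f_n+\vec\varepsilon_n$ with $\vec\varepsilon_n\sim\mathcal N_n(0,I)$. $W^1$ is a mean-zero Gaussian process on $\mathcal X$, $U_n$ the (nonzero) covariance matrix of $(W^1_{x_{1,n}},\dots,W^1_{x_{n,n}})$, with orthonormal eigenbasis $e_{1,n},\dots,e_{n,n}$ and eigenvalues $\lambda_{1,n},\dots,\lambda_{n,n}$; $f_{j,n}=\vec f_n^Te_{j,n}$, $Z_{j,n}=\vec\varepsilon_n^Te_{j,n}$ (i.i.d. standard normal); $\Sigma_{n,c}=I+cU_n$. $I_n=[\log n/n,n^{m-1}]$ for a fixed constant $m\ge1$. Estimators: likelihood-based $\hat c_n=\operatorname{argmin}_{c\in I_n}[\log\det\Sigma_{n,c}+\vec Y_n^T\Sigma_{n,c}^{-1}\vec Y_n]$; risk-based $\hat c_n=\operatorname{argmin}_{c\in I_n}[\operatorname{tr}((I-\Sigma_{n,c}^{-1})^2)-\operatorname{tr}(\Sigma_{n,c}^{-2})+\vec Y_n^T\Sigma_{n,c}^{-2}\vec Y_n]$. Risk-based functions: $D_{1,n}^R(c,f)=\sum_{j=1}^n\frac{f_{j,n}^2}{(1+c\lambda_{j,n})^2}$, $D_{2,n}^R(c)=\sum_{j=1}^n\frac{(c\lambda_{j,n})^2}{(1+c\lambda_{j,n})^2}$,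 $R_{1,n}^R(c,f)=2\sum_{j=1}^n\frac{Z_{j,n}f_{j,n}}{(1+c\lambda_{j,n})^2}$, $R_{2,n}^R(c)=\sum_{j=1}^n(Z_{j,n}^2-1)\bigl[\frac1{(1+c\lambda_{j,n})^2}-1\bigr]$. Likelihood-based functions: $D_{1,n}^L(c,f)=\sum_{j=1}^n\frac{f_{j,n}^2}{1+c\lambda_{j,n}}$, $D_{2,n}^L(c)=\sum_{j=1}^n\bigl[\log(1+c\lambda_{j,n})-\frac{c\lambda_{j,n}}{1+c\lambda_{j,n}}\bigr]$, $R_{1,n}^L(c,f)=2\sum_{j=1}^n\frac{Z_{j,n}f_{j,n}}{1+c\lambda_{j,n}}$, $R_{2,n}^L(c)=-\sum_{j=1}^n\frac{(Z_{j,n}^2-1)c\lambda_{j,n}}{1+c\lambda_{j,n}}$. Good bias condition relative to $D_{1,n}$, with constant $a>0$ (independent of $n$): $D_{1,n}(Kc,f)\le K^{-a}D_{1,n}(c,f)$ for all $c\in I_n$ and all $K>1$. Good variance functions with constants $b,B,B'>0$ (independent of $n$): $Bk^bD_{2,n}(c)\le D_{2,n}(kc)\le B'k^bD_{2,n}(c)$ for all $c\in I_n$ and $k\in(0,1)$ with $kc\in I_n$. *)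

theory Defs
  imports "HOL-Probability.Probability" "Jordan_Normal_Form.Gauss_Jordan_Elimination"
    "Jordan_Normal_Form.Char_Poly"
begin

text \<open>Vectors of length \<open>n\<close> and matrices of size \<open>n\<close> are those of \<open>Jordan_Normal_Form\<close>, so indices run
  over \<open>0, ..., n - 1\<close> instead of \<open>1, ..., n\<close>.\<close>

text \<open>The centred normal law with standard deviation \<open>s\<close>; it is the point mass at 0 if \<open>s = 0\<close>.\<close>

definition centred_normal :: "real \<Rightarrow> real measure" where
  "centred_normal s = (if s = 0 then return borel 0 else density lborel (normal_density 0 s))"

definition centred_gaussian_process :: "'p measure \<Rightarrow> 'x set \<Rightarrow> ('x \<Rightarrow> 'p \<Rightarrow> real) \<Rightarrow> bool" where
  "centred_gaussian_process N X W \<longleftrightarrow>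
     prob_space N \<and>
     (\<forall>t\<in>X. W t \<in> borel_measurable N) \<and>
     (\<forall>F (a :: 'x \<Rightarrow> real). finite F \<and> F \<subseteq> X \<longrightarrow>
        (\<exists>s\<ge>0. distr N borel (\<lambda>\<omega>. \<Sum>t\<in>F. a t * W t \<omega>) = centred_normal s))"

definition covariance :: "'p measure \<Rightarrow> ('p \<Rightarrow> real) \<Rightarrow> ('p \<Rightarrow> real) \<Rightarrow> real" where
  "covariance N V V' =
     (\<integral>\<omega>. (V \<omega> - (\<integral>\<omega>'. V \<omega>' \<partial>N)) * (V' \<omega> - (\<integral>\<omega>'. V' \<omega>' \<partial>N)) \<partial>N)"

definition cov_matrix ::
  "'p measure \<Rightarrow> ('x \<Rightarrow> 'p \<Rightarrow> real) \<Rightarrow> (nat \<Rightarrow> nat \<Rightarrow> 'x) \<Rightarrow> nat \<Rightarrow> real Matrix.mat" where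
  "cov_matrix N W x n = Matrix.mat n n (\<lambda>(i, j). covariance N (W (x n i)) (W (x n j)))"

definition orthonormal_eigenbasis ::
  "nat \<Rightarrow> real Matrix.mat \<Rightarrow> (nat \<Rightarrow> real Matrix.vec) \<Rightarrow> (nat \<Rightarrow> real) \<Rightarrow> bool" where
  "orthonormal_eigenbasis n U e lam \<longleftrightarrow>
     (\<forall>j<n. eigenvector U (e j) (lam j)) \<and>
     (\<forall>j<n. \<forall>k<n. scalar_prod (e j) (e k) = (if j = k then 1 else 0))"

definition standard_normal_vector :: "'w measure \<Rightarrow> nat \<Rightarrow> (nat \<Rightarrow> 'w \<Rightarrow> real) \<Rightarrow> bool" where
  "standard_normal_vector M n eps \<longleftrightarrow>
     prob_space M \<and>
     prob_space.indep_vars M (\<lambda>_. borel) eps {..<n} \<and>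
     (\<forall>i<n. distributed M lborel (eps i) std_normal_density)"

definition fvec :: "(nat \<Rightarrow> nat \<Rightarrow> 'x) \<Rightarrow> ('x \<Rightarrow> real) \<Rightarrow> nat \<Rightarrow> real Matrix.vec" where
  "fvec x f n = Matrix.vec n (\<lambda>i. f (x n i))"

definition noise :: "(nat \<Rightarrow> nat \<Rightarrow> 'w \<Rightarrow> real) \<Rightarrow> nat \<Rightarrow> 'w \<Rightarrow> real Matrix.vec" where
  "noise eps n \<omega> = Matrix.vec n (\<lambda>i. eps n i \<omega>)"

definition coef :: "real Matrix.vec \<Rightarrow> (nat \<Rightarrow> real Matrix.vec) \<Rightarrow> nat \<Rightarrow> real" where
  "coef v e j = scalar_prod v (e j)"

definition scale_interval :: "real \<Rightarrow> nat \<Rightarrow> real set" where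
  "scale_interval m n = {ln (real n) / real n .. real n powr (m - 1)}"

datatype eb_kind = Risk | Likelihood

definition mat_trace :: "real Matrix.mat \<Rightarrow> real" where
  "mat_trace A = (\<Sum>i<dim_row A. A $$ (i, i))"

definition Sigma_mat :: "nat \<Rightarrow> real Matrix.mat \<Rightarrow> real \<Rightarrow> real Matrix.mat" where
  "Sigma_mat n U c = 1\<^sub>m n + c \<cdot>\<^sub>m U"

definition Sigma_inv :: "nat \<Rightarrow> real Matrix.mat \<Rightarrow> real \<Rightarrow> real Matrix.mat" where
  "Sigma_inv n U c = the (mat_inverse (Sigma_mat n U c))"

fun criterion ::
  "eb_kind \<Rightarrow> nat \<Rightarrow> real Matrix.mat \<Rightarrow> real Matrix.vec \<Rightarrow> real \<Rightarrow> real" where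
  "criterion Risk n U y c =
     mat_trace ((1\<^sub>m n - Sigma_inv n U c) ^\<^sub>m 2) - mat_trace (Sigma_inv n U c ^\<^sub>m 2)
     + scalar_prod y ((Sigma_inv n U c ^\<^sub>m 2) *\<^sub>v y)"
| "criterion Likelihood n U y c =
     ln (Determinant.det (Sigma_mat n U c)) + scalar_prod y (Sigma_inv n U c *\<^sub>v y)"

text \<open>Below, \<open>lam\<close> are the eigenvalues, and \<open>g\<close> and \<open>Z\<close> the coefficients of the regression function and
  of the noise with respect to the eigenbasis, all for one fixed \<open>n\<close>.\<close>

fun D1 :: "eb_kind \<Rightarrow> nat \<Rightarrow> (nat \<Rightarrow> real) \<Rightarrow> (nat \<Rightarrow> real) \<Rightarrow> real \<Rightarrow> real" where
  "D1 Risk n lam g c = (\<Sum>j<n. (g j)\<^sup>2 / (1 + c * lam j)\<^sup>2)"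
| "D1 Likelihood n lam g c = (\<Sum>j<n. (g j)\<^sup>2 / (1 + c * lam j))"

fun D2 :: "eb_kind \<Rightarrow> nat \<Rightarrow> (nat \<Rightarrow> real) \<Rightarrow> real \<Rightarrow> real" where
  "D2 Risk n lam c = (\<Sum>j<n. (c * lam j)\<^sup>2 / (1 + c * lam j)\<^sup>2)"
| "D2 Likelihood n lam c = (\<Sum>j<n. ln (1 + c * lam j) - c * lam j / (1 + c * lam j))"

definition D :: "eb_kind \<Rightarrow> nat \<Rightarrow> (nat \<Rightarrow> real) \<Rightarrow> (nat \<Rightarrow> real) \<Rightarrow> real \<Rightarrow> real" where
  "D k n lam g c = D1 k n lam g c + D2 k n lam c"

fun R1 ::
  "eb_kind \<Rightarrow> nat \<Rightarrow> (nat \<Rightarrow> real) \<Rightarrow> (nat \<Rightarrow> real) \<Rightarrow> (nat \<Rightarrow> real) \<Rightarrow> real \<Rightarrow> real" where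
  "R1 Risk n lam g Z c = 2 * (\<Sum>j<n. Z j * g j / (1 + c * lam j)\<^sup>2)"
| "R1 Likelihood n lam g Z c = 2 * (\<Sum>j<n. Z j * g j / (1 + c * lam j))"

fun R2 :: "eb_kind \<Rightarrow> nat \<Rightarrow> (nat \<Rightarrow> real) \<Rightarrow> (nat \<Rightarrow> real) \<Rightarrow> real \<Rightarrow> real" where
  "R2 Risk n lam Z c = (\<Sum>j<n. ((Z j)\<^sup>2 - 1) * (1 / (1 + c * lam j)\<^sup>2 - 1))"
| "R2 Likelihood n lam Z c = - (\<Sum>j<n. ((Z j)\<^sup>2 - 1) * (c * lam j) / (1 + c * lam j))"

definition tendsto_0_in_prob :: "(nat \<Rightarrow> 'w measure) \<Rightarrow> (nat \<Rightarrow> 'w \<Rightarrow> real) \<Rightarrow> bool" where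
  "tendsto_0_in_prob M V \<longleftrightarrow>
     (\<forall>\<delta>>0. (\<lambda>n. measure (M n) {\<omega> \<in> space (M n). \<bar>V n \<omega>\<bar> > \<delta>}) \<longlonglongrightarrow> 0)"

text \<open>The two conditions below are required for \<open>n \<ge> 2\<close> only. For \<open>n = 1\<close> the interval contains 0, because
  \<open>ln 1 / 1 = 0\<close>, and the bias condition at \<open>c = 0\<close> would force the regression function to vanish at the
  only design point.\<close>

definition good_bias :: "(nat \<Rightarrow> real set) \<Rightarrow> (nat \<Rightarrow> real \<Rightarrow> real) \<Rightarrow> real \<Rightarrow> bool" where
  "good_bias I d1 a \<longleftrightarrow> (\<forall>n\<ge>2. \<forall>c\<in>I n. \<forall>K>1. d1 n (K * c) \<le> K powr (- a) * d1 n c)"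

definition good_variance ::
  "(nat \<Rightarrow> real set) \<Rightarrow> (nat \<Rightarrow> real \<Rightarrow> real) \<Rightarrow> real \<Rightarrow> real \<Rightarrow> real \<Rightarrow> bool" where
  "good_variance I d2 b B B' \<longleftrightarrow>
     (\<forall>n\<ge>2. \<forall>c\<in>I n. \<forall>k. 0 < k \<and> k < 1 \<and> k * c \<in> I n \<longrightarrow>
        B * k powr b * d2 n c \<le> d2 n (k * c) \<and> d2 n (k * c) \<le> B' * k powr b * d2 n c)"

end

theory Submission
  imports Defs
begin

text \<open>In the eigenbasis of the covariance matrix, the criterion at \<open>c\<close> is \<open>D + R1 + R2\<close> plus a random term
  that does not depend on \<open>c\<close>. If \<open>\<bar>R1\<bar> + \<bar>R2\<bar> \<le> \<delta> D\<close> on the whole interval, a minimizer of the criterion therefore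
  minimizes \<open>D\<close> up to the factor \<open>(1 + \<delta>) / (1 - \<delta>)\<close>, which is \<open>1 + \<epsilon>\<close> for \<open>\<delta> = \<epsilon> / (2 + \<epsilon>)\<close>. The second claim
  holds on the same event: it follows by comparison with a point where bias and variance balance.\<close>

section \<open>Spectral calculus in an orthonormal eigenbasis\<close>

locale eigenbasis =
  fixes n :: nat
    and U :: "real Matrix.mat"
    and e :: "nat \<Rightarrow> real Matrix.vec"
    and lam :: "nat \<Rightarrow> real"
  assumes U_carrier [simp]: "U \<in> carrier_mat n n"
    and eigen: "orthonormal_eigenbasis n U e lam"
begin

lemma e_carrier [simp]: "j < n \<Longrightarrow> e j \<in> carrier_vec n"
  using eigen U_carrier by (auto simp: orthonormal_eigenbasis_def eigenvector_def)

lemma U_mult_e: "j < n \<Longrightarrow> U *\<^sub>v e j = lam j \<cdot>\<^sub>v e j"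
  using eigen by (auto simp: orthonormal_eigenbasis_def eigenvector_def)

lemma e_orthonormal: "j < n \<Longrightarrow> k < n \<Longrightarrow> scalar_prod (e j) (e k) = (if j = k then 1 else 0)"
  using eigen by (auto simp: orthonormal_eigenbasis_def)

definition P :: "real Matrix.mat" where
  "P = Matrix.mat n n (\<lambda>(i, j). vec_index (e j) i)"

text \<open>The matrix with eigenvectors \<open>e j\<close> and eigenvalues \<open>h j\<close>.
  Every matrix in the criterion has this form, so products, inverses, traces and determinants become
  pointwise operations on \<open>h\<close>.\<close>

definition spec :: "(nat \<Rightarrow> real) \<Rightarrow> real Matrix.mat" where
  "spec h = P * mat_diag n h * transpose_mat P"

lemma P_carrier [simp]: "P \<in> carrier_mat n n" "transpose_mat P \<in> carrier_mat n n"
  by (simp_all add: P_def)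

lemma dims [simp]:
  "dim_row P = n" "dim_col P = n" "dim_row U = n" "dim_col U = n" "j < n \<Longrightarrow> dim_vec (e j) = n"
  by (rule carrier_matD[OF P_carrier(1)] carrier_matD[OF U_carrier] carrier_vecD[OF e_carrier];
      assumption?)+

lemma spec_carrier [simp]: "spec h \<in> carrier_mat n n"
  by (auto simp: spec_def intro!: mult_carrier_mat[of _ _ n])

lemma spec_dim [simp]: "dim_row (spec h) = n" "dim_col (spec h) = n"
  using spec_carrier[of h] by blast+

lemma col_P: "j < n \<Longrightarrow> col P j = e j"
  by (intro eq_vecI) (auto simp: P_def)

lemma transpose_P_mult_P: "transpose_mat P * P = 1\<^sub>m n"
  by (rule eq_matI) (auto simp: col_P e_orthonormal)

text \<open>A left inverse of a square matrix is also a right inverse; orthonormality of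
  \<open>n\<close> vectors thus yields completeness.\<close>

lemma P_mult_transpose_P: "P * transpose_mat P = 1\<^sub>m n"
  by (rule mat_mult_left_right_inverse[OF _ _ transpose_P_mult_P]) auto

lemma spec_mult: "spec h * spec k = spec (\<lambda>j. h j * k j)"
proof -
  have "spec h * spec k = P * (mat_diag n h * (transpose_mat P * P) * mat_diag n k) * transpose_mat P"
    by (simp add: spec_def assoc_mult_mat[of _ n n _ n _ n] mult_carrier_mat[of _ n n _ n])
  then show ?thesis
    by (simp add: transpose_P_mult_P spec_def right_mult_one_mat[of _ n n])
qed

lemma spec_index:
  assumes "i < n" "j < n"
  shows "spec h $$ (i, j) = (\<Sum>k<n. vec_index (e k) i * h k * vec_index (e k) j)"
  using assms
  by (auto simp: spec_def mat_diag_mult_right[of _ n n] P_def scalar_prod_def atLeast0LessThan)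

lemma spec_one: "spec (\<lambda>_. 1) = 1\<^sub>m n"
  by (simp add: spec_def P_mult_transpose_P right_mult_one_mat[of _ n n])

lemma spec_add: "spec h + spec k = spec (\<lambda>j. h j + k j)"
  by (rule eq_matI) (auto simp: spec_index sum.distrib algebra_simps)

lemma spec_minus: "spec h - spec k = spec (\<lambda>j. h j - k j)"
  by (rule eq_matI) (auto simp: spec_index sum_subtractf algebra_simps)

lemma spec_smult: "c \<cdot>\<^sub>m spec h = spec (\<lambda>j. c * h j)"
  by (rule eq_matI) (auto simp: spec_index sum_distrib_left algebra_simps)

lemma spec_pow2: "spec h ^\<^sub>m 2 = spec (\<lambda>j. (h j)\<^sup>2)"
  by (simp add: numeral_2_eq_2 spec_mult left_mult_one_mat[of _ n n])

text \<open>Column \<open>j\<close> of \<open>U * P\<close> is \<open>lam j\<close> times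
  \<open>e j\<close>, so \<open>U * P = P * mat_diag n lam\<close>; multiplication by the transpose
  of \<open>P\<close> on the right isolates \<open>U\<close>.\<close>

lemma U_eq_spec: "U = spec lam"
proof -
  have UP: "U * P = P * mat_diag n lam"
  proof (rule eq_matI)
    fix i j assume "i < dim_row (P * mat_diag n lam)" "j < dim_col (P * mat_diag n lam)"
    then have ij: "i < n" "j < n"
      by (auto simp: mat_diag_def)
    have "(U * P) $$ (i, j) = vec_index (U *\<^sub>v e j) i"
      using ij by (simp add: col_P)
    also have "\<dots> = (P * mat_diag n lam) $$ (i, j)"
      using ij by (auto simp: U_mult_e mat_diag_mult_right[of _ n n] P_def)
    finally show "(U * P) $$ (i, j) = (P * mat_diag n lam) $$ (i, j)" .
  qed (auto simp: mat_diag_def)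
  have "U = U * (P * transpose_mat P)"
    by (simp add: P_mult_transpose_P right_mult_one_mat[of _ n n])
  also have "\<dots> = U * P * transpose_mat P"
    by (rule assoc_mult_mat[symmetric]) auto
  finally show ?thesis
    by (simp add: UP spec_def)
qed

lemma det_spec: "Determinant.det (spec h) = (\<Prod>j<n. h j)"
proof -
  have "Determinant.det P * Determinant.det (transpose_mat P) = 1"
    using arg_cong[OF P_mult_transpose_P, of Determinant.det]
    by (simp add: det_mult[of _ n])
  moreover have "Determinant.det (mat_diag n h) = (\<Prod>j<n. h j)"
    by (subst det_upper_triangular[of _ n])
      (auto simp: mat_diag_def upper_triangular_def prod_list_diag_prod atLeast0LessThan)
  ultimately show ?thesis
    by (simp add: spec_def det_mult[of _ n] mult_carrier_mat[of _ n n] algebra_simps)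
qed

text \<open>After exchanging the sums, the weight of \<open>h k\<close> is the squared norm of
  \<open>e k\<close>, which is 1.\<close>

lemma trace_spec: "mat_trace (spec h) = (\<Sum>j<n. h j)"
proof -
  have "mat_trace (spec h) = (\<Sum>i<n. \<Sum>k<n. vec_index (e k) i * h k * vec_index (e k) i)"
    by (simp add: mat_trace_def spec_index)
  also have "\<dots> = (\<Sum>k<n. h k * (\<Sum>i<n. vec_index (e k) i * vec_index (e k) i))"
    by (subst sum.swap) (simp add: sum_distrib_left algebra_simps)
  also have "\<dots> = (\<Sum>k<n. h k * scalar_prod (e k) (e k))"
    by (intro sum.cong) (auto simp: scalar_prod_def atLeast0LessThan dest!: e_carrier)
  finally show ?thesis
    by (simp add: e_orthonormal)
qed

text \<open>The entries of \<open>spec h\<close> turn the form into a triple sum. With the spectral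
  index outermost, the other two sums factor into the square of one coefficient.\<close>

lemma scalar_prod_spec:
  assumes y: "y \<in> carrier_vec n"
  shows "scalar_prod y (spec h *\<^sub>v y) = (\<Sum>j<n. h j * (coef y e j)\<^sup>2)"
proof -
  have c: "coef y e j = (\<Sum>i<n. vec_index y i * vec_index (e j) i)" if "j < n" for j
    using e_carrier[OF that] by (auto simp: coef_def scalar_prod_def atLeast0LessThan)
  have "scalar_prod y (spec h *\<^sub>v y) =
      (\<Sum>i<n. vec_index y i * (\<Sum>j<n. spec h $$ (i, j) * vec_index y j))"
    using y by (auto simp: scalar_prod_def atLeast0LessThan)
  also have "\<dots> = (\<Sum>i<n. \<Sum>j<n. \<Sum>k<n.
      h k * ((vec_index y i * vec_index (e k) i) * (vec_index y j * vec_index (e k) j)))"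
    by (simp add: spec_index sum_distrib_left sum_distrib_right algebra_simps)
  also have "\<dots> = (\<Sum>k<n. \<Sum>i<n. \<Sum>j<n.
      h k * ((vec_index y i * vec_index (e k) i) * (vec_index y j * vec_index (e k) j)))"
    by (rule trans[OF sum.cong[OF refl sum.swap] sum.swap])
  also have "\<dots> = (\<Sum>k<n. h k * (coef y e k)\<^sup>2)"
    by (simp add: c power2_eq_square flip: sum_distrib_left sum_distrib_right)
  finally show ?thesis .
qed

lemma Sigma_mat_eq_spec: "Sigma_mat n U c = spec (\<lambda>j. 1 + c * lam j)"
proof -
  have "Sigma_mat n U c = spec (\<lambda>_. 1) + c \<cdot>\<^sub>m spec lam"
    by (simp only: Sigma_mat_def spec_one U_eq_spec[symmetric])
  then show ?thesis
    by (simp add: spec_add spec_smult)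
qed

text \<open>\<open>Sigma_inv\<close> takes \<open>the\<close> of an option, so the existence of an
  inverse comes first; the inverse is then identified with the reciprocal candidate
  \<open>?T\<close> by uniqueness.\<close>

lemma Sigma_inv_eq_spec:
  assumes pos: "\<And>j. j < n \<Longrightarrow> 1 + c * lam j > 0"
  shows "Sigma_inv n U c = spec (\<lambda>j. 1 / (1 + c * lam j))"
proof -
  let ?S = "spec (\<lambda>j. 1 + c * lam j)" and ?T = "spec (\<lambda>j. 1 / (1 + c * lam j))"
  \<comment> \<open>\<open>spec h\<close> sees \<open>h\<close> only at indices below
    \<open>n\<close>, and positivity is known only there; the comparison is therefore by entries and
    not by equality of functions.\<close>
  have cong: "spec h = 1\<^sub>m n" if "\<And>j. j < n \<Longrightarrow> h j = 1" for h
    unfolding spec_one[symmetric] using that by (intro eq_matI) (auto simp: spec_index)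
  have nz: "1 + c * lam j \<noteq> 0" if "j < n" for j
    using pos[OF that] by simp
  have ST: "?S * ?T = 1\<^sub>m n" and TS: "?T * ?S = 1\<^sub>m n"
    by (auto simp: spec_mult nz intro!: cong)
  have "mat_inverse ?S \<noteq> None"
    using mat_inverse(1)[OF spec_carrier, of "\<lambda>j. 1 + c * lam j"] ST TS
    by (force simp: Units_def ring_mat_def)
  then obtain B where B: "mat_inverse ?S = Some B"
    by auto
  from mat_inverse(2)[OF spec_carrier B]
  have "?S * B = 1\<^sub>m n" "B * ?S = 1\<^sub>m n" and Bc: "B \<in> carrier_mat n n"
    by auto
  then have "B = ?T * ?S * B"
    by (simp add: TS)
  also have "\<dots> = ?T * (?S * B)"
    using Bc by (intro assoc_mult_mat) auto
  finally have "B = ?T"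
    using \<open>?S * B = 1\<^sub>m n\<close> by (simp add: right_mult_one_mat[of _ n n])
  then show ?thesis
    by (simp add: Sigma_inv_def Sigma_mat_eq_spec B)
qed

text \<open>The Rayleigh quotient of the unit vector \<open>e j\<close>: a nonnegative quadratic
  form forces nonnegative eigenvalues.\<close>

lemma lam_eq_quadratic_form:
  assumes "j < n"
  shows "lam j = (\<Sum>i<n. \<Sum>k<n. vec_index (e j) i * vec_index (e j) k * U $$ (i, k))"
proof -
  have "lam j = scalar_prod (e j) (U *\<^sub>v e j)"
    using assms by (simp add: U_mult_e e_orthonormal)
  also have "\<dots> = (\<Sum>i<n. vec_index (e j) i * (\<Sum>k<n. U $$ (i, k) * vec_index (e j) k))"
    using assms by (auto simp: scalar_prod_def atLeast0LessThan)
  finally show ?thesis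
    by (simp add: sum_distrib_left mult.assoc mult.commute mult.left_commute)
qed

lemma ex_lam_nonzero:
  assumes "U \<noteq> 0\<^sub>m n n"
  shows "\<exists>j<n. lam j \<noteq> 0"
proof (rule ccontr)
  assume "\<not> (\<exists>j<n. lam j \<noteq> 0)"
  then have "spec lam = 0\<^sub>m n n"
    by (intro eq_matI) (auto simp: spec_index)
  with assms U_eq_spec show False
    by simp
qed

lemma coef_add:
  assumes "v \<in> carrier_vec n" "w \<in> carrier_vec n" "j < n"
  shows "coef (v + w) e j = coef v e j + coef w e j"
  using assms by (simp add: coef_def add_scalar_prod_distrib[of _ n])

text \<open>The coefficients of the data are sums of signal and noise coefficients. Once their
  squares are expanded, the identity holds coordinate by coordinate. The last sum collects what the
  centring of the noise in \<open>R2\<close> leaves over; it is free of \<open>c\<close>.\<close>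

lemma criterion_eq:
  assumes v: "v \<in> carrier_vec n" and w: "w \<in> carrier_vec n"
    and pos: "\<And>j. j < n \<Longrightarrow> 1 + c * lam j > 0"
  shows "criterion kind n U (v + w) c =
    D kind n lam (coef v e) c + R1 kind n lam (coef v e) (coef w e) c + R2 kind n lam (coef w e) c
    + (\<Sum>j<n. (coef w e j)\<^sup>2 - (case kind of Risk \<Rightarrow> 1 | Likelihood \<Rightarrow> 0))"
proof (cases kind)
  case Risk
  let ?s = "\<lambda>j. 1 + c * lam j"
  have vw: "v + w \<in> carrier_vec n"
    using v w by simp
  have "criterion Risk n U (v + w) c = (\<Sum>j<n. (1 - 1 / ?s j)\<^sup>2 - (1 / ?s j)\<^sup>2
      + (1 / ?s j)\<^sup>2 * (coef (v + w) e j)\<^sup>2)"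
    by (simp add: Sigma_inv_eq_spec[OF pos] spec_one[symmetric] spec_minus spec_pow2 trace_spec
        scalar_prod_spec[OF vw] sum.distrib sum_subtractf del: One_nat_def)
  also have "\<dots> = (\<Sum>j<n. (coef v e j)\<^sup>2 / (?s j)\<^sup>2 + (c * lam j)\<^sup>2 / (?s j)\<^sup>2
      + 2 * (coef w e j * coef v e j / (?s j)\<^sup>2)
      + ((coef w e j)\<^sup>2 - 1) * (1 / (?s j)\<^sup>2 - 1) + ((coef w e j)\<^sup>2 - 1))"
  proof (rule sum.cong[OF refl], goal_cases)
    case (1 j)
    then have s: "?s j > 0" and j: "j < n"
      using pos by auto
    \<comment> \<open>In terms of the shrinkage factor \<open>r\<close>, the product
      \<open>c * lam j * r\<close> becomes \<open>1 - r\<close>, and the claim is a polynomial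
      identity.\<close>
    define r where "r = 1 / ?s j"
    have r: "c * lam j * r = 1 - r"
      using s by (simp add: r_def field_simps)
    have "x / (?s j)\<^sup>2 = x * r\<^sup>2" for x
      by (simp add: r_def power_divide)
    moreover have "(c * lam j)\<^sup>2 * r\<^sup>2 = (1 - r)\<^sup>2"
      by (simp only: r[symmetric] power_mult_distrib)
    ultimately show ?case
      unfolding coef_add[OF v w j] r_def[symmetric]
      by (simp add: power2_eq_square algebra_simps)
  qed
  also have "\<dots> = D Risk n lam (coef v e) c + R1 Risk n lam (coef v e) (coef w e) c
      + R2 Risk n lam (coef w e) c + (\<Sum>j<n. (coef w e j)\<^sup>2 - 1)"
    by (simp add: D_def sum.distrib sum_distrib_left)
  finally show ?thesis
    by (simp add: Risk)
next
  case Likelihood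
  let ?s = "\<lambda>j. 1 + c * lam j"
  have vw: "v + w \<in> carrier_vec n"
    using v w by simp
  have "?s j \<noteq> 0" if "j < n" for j
    using pos[OF that] by simp
  then have ln_det: "ln (\<Prod>j<n. ?s j) = (\<Sum>j<n. ln (?s j))"
    by (intro ln_prod) auto
  have "criterion Likelihood n U (v + w) c = (\<Sum>j<n. ln (?s j) + 1 / ?s j * (coef (v + w) e j)\<^sup>2)"
    by (simp add: Sigma_inv_eq_spec[OF pos] Sigma_mat_eq_spec det_spec scalar_prod_spec[OF vw]
        sum.distrib ln_det)
  also have "\<dots> = (\<Sum>j<n. (coef v e j)\<^sup>2 / ?s j + (ln (?s j) - c * lam j / ?s j)
      + 2 * (coef w e j * coef v e j / ?s j)
      - ((coef w e j)\<^sup>2 - 1) * (c * lam j) / ?s j + (coef w e j)\<^sup>2)"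
  proof (rule sum.cong[OF refl], goal_cases)
    case (1 j)
    then have s: "?s j > 0" and j: "j < n"
      using pos by auto
    \<comment> \<open>Replacing \<open>c * lam j / ?s j\<close> by \<open>1 - 1 / ?s j\<close>
      leaves only fractions whose numerators are free of \<open>c * lam j\<close>; these match by
      ring arithmetic.\<close>
    have "c * lam j = ?s j - 1"
      by simp
    then have *: "c * lam j / ?s j = 1 - 1 / ?s j"
      "x * (c * lam j) / ?s j = x - x / ?s j" for x
      using s by (simp_all add: field_simps)
    show ?case
      unfolding coef_add[OF v w j] *
      by (simp add: add_divide_distrib diff_divide_distrib power2_eq_square algebra_simps)
  qed
  also have "\<dots> = D Likelihood n lam (coef v e) c + R1 Likelihood n lam (coef v e) (coef w e) c
      + R2 Likelihood n lam (coef w e) c + (\<Sum>j<n. (coef w e j)\<^sup>2)"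
    by (simp add: D_def sum.distrib sum_subtractf sum_distrib_left)
  finally show ?thesis
    by (simp add: Likelihood)
qed

end

section \<open>Positive semidefiniteness of the prior covariance\<close>

lemma centred_normal_square_integrable:
  assumes "s \<ge> 0"
  shows "integrable (centred_normal s) (\<lambda>x. x\<^sup>2)"
proof (cases "s = 0")
  case True
  then show ?thesis
    by (simp add: centred_normal_def integrable_iff_bounded nn_integral_return)
next
  case False
  with assms show ?thesis
    using integrable_normal_moment[of s 0 2]
    by (simp add: centred_normal_def integrable_density)
qed

text \<open>The singleton \<open>F = {t}\<close> with weight 1 in the definition of a Gaussian
  process gives the law of \<open>W t\<close>. Its second moment is finite, also in the degenerate
  case of a point mass.\<close>

lemma gaussian_square_integrable:
  assumes "centred_gaussian_process N X W" "t \<in> X"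
  shows "W t \<in> borel_measurable N" "integrable N (\<lambda>\<omega>. (W t \<omega>)\<^sup>2)"
proof -
  show W [measurable]: "W t \<in> borel_measurable N"
    using assms by (simp add: centred_gaussian_process_def)
  obtain s where s: "s \<ge> 0" "distr N borel (\<lambda>\<omega>. \<Sum>u\<in>{t}. 1 * W u \<omega>) = centred_normal s"
    using assms(1)[unfolded centred_gaussian_process_def, THEN conjunct2, THEN conjunct2,
        rule_format, of "{t}" "\<lambda>_. 1"] assms(2) by auto
  then have "integrable (distr N borel (W t)) (\<lambda>x. x\<^sup>2)"
    using centred_normal_square_integrable[OF s(1)] by simp
  then show "integrable N (\<lambda>\<omega>. (W t \<omega>)\<^sup>2)"
    by (simp add: integrable_distr_eq)
qed

lemma integrable_mult_of_square_integrable: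
  fixes f g :: "'a \<Rightarrow> real"
  assumes [measurable]: "f \<in> borel_measurable N" "g \<in> borel_measurable N"
    and "integrable N (\<lambda>x. (f x)\<^sup>2)" "integrable N (\<lambda>x. (g x)\<^sup>2)"
  shows "integrable N (\<lambda>x. f x * g x)"
proof (rule Bochner_Integration.integrable_bound)
  show "integrable N (\<lambda>x. (f x)\<^sup>2 + (g x)\<^sup>2)"
    using assms by simp
  have "\<bar>a * b\<bar> \<le> a\<^sup>2 + b\<^sup>2" for a b :: real
    using sum_squares_bound[of "\<bar>a\<bar>" "\<bar>b\<bar>"] zero_le_power2[of a] zero_le_power2[of b]
    by (simp only: abs_mult power2_abs)
  then show "AE x in N. norm (f x * g x) \<le> norm ((f x)\<^sup>2 + (g x)\<^sup>2)"
    by (auto simp del: abs_mult)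
qed (use assms in simp)

text \<open>The form is the second moment of the centred combination of the \<open>W (x n i)\<close>
  with weights \<open>v i\<close>. Square integrability makes all products integrable, as the
  exchange of sums and expectation requires.\<close>

lemma cov_matrix_quadratic_form_nonneg:
  assumes gp: "centred_gaussian_process N X W" and design: "\<And>i. i < n \<Longrightarrow> x n i \<in> X"
  shows "(\<Sum>i<n. \<Sum>j<n. v i * v j * covariance N (W (x n i)) (W (x n j))) \<ge> 0"
proof -
  interpret prob_space N
    using gp by (simp add: centred_gaussian_process_def)
  define V where "V i \<omega> = W (x n i) \<omega> - expectation (W (x n i))" for i \<omega>
  have meas: "W (x n i) \<in> borel_measurable N" and sq: "integrable N (\<lambda>\<omega>. (W (x n i) \<omega>)\<^sup>2)"
    if "i < n" for i
    using gaussian_square_integrable[OF gp design[OF that]] by auto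
  have V: "V i \<in> borel_measurable N" "integrable N (\<lambda>\<omega>. (V i \<omega>)\<^sup>2)" if "i < n" for i
  proof -
    note [measurable] = meas[OF that]
    show "V i \<in> borel_measurable N"
      unfolding V_def by measurable
    have "integrable N (W (x n i))"
      using square_integrable_imp_integrable[OF meas[OF that] sq[OF that]] .
    then show "integrable N (\<lambda>\<omega>. (V i \<omega>)\<^sup>2)"
      using sq[OF that] by (simp add: V_def power2_diff)
  qed
  have int: "integrable N (\<lambda>\<omega>. V i \<omega> * V j \<omega>)" if "i < n" "j < n" for i j
    using that V by (intro integrable_mult_of_square_integrable) auto
  have "(\<Sum>i<n. \<Sum>j<n. v i * v j * covariance N (W (x n i)) (W (x n j))) =
      (\<Sum>i<n. \<Sum>j<n. expectation (\<lambda>\<omega>. v i * v j * (V i \<omega> * V j \<omega>)))"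
    by (simp add: covariance_def V_def)
  also have "\<dots> = (\<Sum>i<n. expectation (\<lambda>\<omega>. \<Sum>j<n. v i * v j * (V i \<omega> * V j \<omega>)))"
    by (intro sum.cong refl Bochner_Integration.integral_sum[symmetric]) (auto intro!: int)
  also have "\<dots> = expectation (\<lambda>\<omega>. \<Sum>i<n. \<Sum>j<n. v i * v j * (V i \<omega> * V j \<omega>))"
    by (intro Bochner_Integration.integral_sum[symmetric] Bochner_Integration.integrable_sum)
      (auto intro!: int)
  also have "\<dots> = expectation (\<lambda>\<omega>. (\<Sum>i<n. v i * V i \<omega>)\<^sup>2)"
    by (simp add: power2_eq_square sum_product mult.assoc mult.left_commute)
  also have "\<dots> \<ge> 0"
    by (intro Bochner_Integration.integral_nonneg) simp
  finally show ?thesis .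
qed

section \<open>Analytic properties of bias, variance and remainder terms\<close>

lemma D_borel_measurable [measurable]:
  "D1 kind n lam g \<in> borel_measurable borel" "D2 kind n lam \<in> borel_measurable borel"
  "D kind n lam g \<in> borel_measurable borel"
proof -
  have *: "D1 kind n lam g = (case kind of Risk \<Rightarrow> (\<lambda>c. \<Sum>j<n. (g j)\<^sup>2 / (1 + c * lam j)\<^sup>2)
      | Likelihood \<Rightarrow> (\<lambda>c. \<Sum>j<n. (g j)\<^sup>2 / (1 + c * lam j)))"
    "D2 kind n lam = (case kind of Risk \<Rightarrow> (\<lambda>c. \<Sum>j<n. (c * lam j)\<^sup>2 / (1 + c * lam j)\<^sup>2)
      | Likelihood \<Rightarrow> (\<lambda>c. \<Sum>j<n. ln (1 + c * lam j) - c * lam j / (1 + c * lam j)))"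
    by (cases kind; auto)+
  show 1: "D1 kind n lam g \<in> borel_measurable borel"
    unfolding * by (cases kind; simp)
  show 2: "D2 kind n lam \<in> borel_measurable borel"
    unfolding * by (cases kind; simp)
  have "D kind n lam g = (\<lambda>c. D1 kind n lam g c + D2 kind n lam c)"
    by (simp add: D_def fun_eq_iff)
  then show "D kind n lam g \<in> borel_measurable borel"
    using 1 2 by simp
qed

text \<open>The derivative at \<open>u\<close> is \<open>u / (1 + u)\<^sup>2\<close>. It is positive
  for \<open>u > 0\<close> but vanishes at 0, hence the monotonicity criterion on the open interval.
  The case \<open>s = 0\<close> gives positivity of the likelihood variance terms.\<close>

lemma ln_minus_fraction_strict_mono:
  fixes s t :: real
  assumes "0 \<le> s" "s < t"
  shows "ln (1 + s) - s / (1 + s) < ln (1 + t) - t / (1 + t)"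
proof (rule DERIV_pos_imp_increasing_open[OF assms(2)])
  fix u assume u: "s < u" "u < t"
  with assms have "u > 0"
    by simp
  then have "1 / (1 + u) - (1 + u - u) / ((1 + u) * (1 + u)) = u / (1 + u)\<^sup>2"
    by (simp add: power2_eq_square divide_simps)
  with \<open>u > 0\<close> have "((\<lambda>u. ln (1 + u) - u / (1 + u)) has_real_derivative u / (1 + u)\<^sup>2) (at u)"
    by (auto intro!: derivative_eq_intros)
  then show "\<exists>y. ((\<lambda>u. ln (1 + u) - u / (1 + u)) has_real_derivative y) (at u) \<and> y > 0"
    using \<open>u > 0\<close> by force
qed (use assms in \<open>auto intro!: continuous_intros\<close>)

context
  fixes n :: nat and lam :: "nat \<Rightarrow> real"
  assumes lam: "\<And>j. j < n \<Longrightarrow> lam j \<ge> 0"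
begin

lemma one_plus_pos: "j < n \<Longrightarrow> c \<ge> 0 \<Longrightarrow> 1 + c * lam j > 0"
  using mult_nonneg_nonneg[OF _ lam, of c j] by linarith

lemma D1_nonneg: "c \<ge> 0 \<Longrightarrow> D1 kind n lam g c \<ge> 0"
  by (cases kind) (auto intro!: sum_nonneg divide_nonneg_nonneg simp: less_imp_le one_plus_pos)

text \<open>All denominators are at least 1. At the right end of the interval this ties the bias to
  the condition on the sum of squares.\<close>

lemma D1_le_sum_squares: "c \<ge> 0 \<Longrightarrow> D1 kind n lam g c \<le> (\<Sum>j<n. (g j)\<^sup>2)"
proof -
  assume c: "c \<ge> 0"
  have *: "x / y \<le> x" if "x \<ge> 0" "y \<ge> 1" for x y :: real
    using that divide_left_mono[of 1 y x] by simp
  have "1 + c * lam j \<ge> 1" if "j < n" for j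
    using lam[OF that] c by simp
  then show ?thesis
    by (cases kind) (auto intro!: sum_mono * one_le_power)
qed

text \<open>Each summand is a function of \<open>c * lam j\<close> that increases on the nonnegative
  half-line. Hence the supremum of the variance over an interval is its value at the right
  end.\<close>

lemma D2_mono:
  assumes c: "0 \<le> c" "c \<le> d"
  shows "D2 kind n lam c \<le> D2 kind n lam d"
proof -
  have cd: "0 \<le> c * lam j" "c * lam j \<le> d * lam j" if "j < n" for j
    using lam[OF that] c by (auto intro: mult_right_mono)
  show ?thesis
  proof (cases kind)
    case Risk
    have "(s / (1 + s))\<^sup>2 \<le> (t / (1 + t))\<^sup>2" if "0 \<le> s" "s \<le> t" for s t :: real
      using that by (intro power_mono) (auto simp: frac_le_eq divide_simps algebra_simps)
    then show ?thesis
      using cd by (auto simp: Risk power_divide intro!: sum_mono)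
  next
    case Likelihood
    have "ln (1 + s) - s / (1 + s) \<le> ln (1 + t) - t / (1 + t)" if "0 \<le> s" "s \<le> t" for s t :: real
      using ln_minus_fraction_strict_mono[of s t] that by (cases "s = t") auto
    then show ?thesis
      using cd by (auto simp: Likelihood intro!: sum_mono)
  qed
qed

text \<open>One nonzero eigenvalue makes one summand positive, and the others are
  nonnegative.\<close>

lemma D2_pos:
  assumes "c > 0" and "j < n" "lam j \<noteq> 0"
  shows "D2 kind n lam c > 0"
proof -
  have cl: "0 \<le> c * lam i" if "i < n" for i
    using lam[OF that] assms by simp
  have clj: "0 < c * lam j"
    using lam[of j] assms by (simp add: order_less_le)
  show ?thesis
  proof (cases kind)
    case Risk
    have "1 + c * lam j \<noteq> 0"
      using clj by linarith
    then have "(c * lam j)\<^sup>2 / (1 + c * lam j)\<^sup>2 > 0"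
      using clj by (intro divide_pos_pos) auto
    then show ?thesis
      using assms by (auto simp: Risk intro!: sum_pos2[of _ j])
  next
    case Likelihood
    have "ln (1 + s) - s / (1 + s) \<ge> 0" if "0 \<le> s" for s :: real
      using ln_minus_fraction_strict_mono[of 0 s] that by (cases "s = 0") auto
    then show ?thesis
      using assms cl ln_minus_fraction_strict_mono[of 0 "c * lam j"] clj
      by (auto simp: Likelihood intro!: sum_pos2[of _ j])
  qed
qed

lemma continuous_D_R:
  assumes I: "\<And>c. c \<in> I \<Longrightarrow> c \<ge> 0"
  shows "continuous_on I (D1 kind n lam g)" "continuous_on I (D2 kind n lam)"
    "continuous_on I (D kind n lam g)"
    "continuous_on I (R1 kind n lam g Z)" "continuous_on I (R2 kind n lam Z)"
proof -
  have nz: "1 + c * lam j \<noteq> 0" "\<not> 1 + c * lam j \<le> 0" if "j < n" "c \<in> I" for j c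
    using one_plus_pos[OF that(1) I[OF that(2)]] by auto
  have eqs: "D1 kind n lam g = (\<lambda>c. D1 kind n lam g c)" "D2 kind n lam = (\<lambda>c. D2 kind n lam c)"
    "D kind n lam g = (\<lambda>c. D1 kind n lam g c + D2 kind n lam c)"
    "R1 kind n lam g Z = (\<lambda>c. R1 kind n lam g Z c)" "R2 kind n lam Z = (\<lambda>c. R2 kind n lam Z c)"
    by (simp_all add: D_def fun_eq_iff)
  show 1: "continuous_on I (D1 kind n lam g)"
    by (subst eqs, cases kind) (auto intro!: continuous_intros simp: nz)
  show 2: "continuous_on I (D2 kind n lam)"
    by (subst eqs, cases kind) (auto intro!: continuous_intros simp: nz)
  show "continuous_on I (D kind n lam g)"
    unfolding eqs(3) by (intro continuous_intros 1 2)
  show "continuous_on I (R1 kind n lam g Z)"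
    by (subst eqs, cases kind) (auto intro!: continuous_intros simp: nz)
  show "continuous_on I (R2 kind n lam Z)"
    by (subst eqs, cases kind) (auto intro!: continuous_intros simp: nz)
qed

end

section \<open>Deterministic comparison of near-minimizers\<close>

lemma perturbed_argmin_bound:
  fixes d r :: "'a \<Rightarrow> real"
  assumes "\<epsilon> > 0" and "c0 \<in> I"
    and min: "\<And>c. c \<in> I \<Longrightarrow> d c0 + r c0 \<le> d c + r c"
    and small: "\<And>c. c \<in> I \<Longrightarrow> \<bar>r c\<bar> \<le> \<epsilon> / (2 + \<epsilon>) * d c"
  shows "d c0 \<le> (1 + \<epsilon>) * (INF c\<in>I. d c)"
proof -
  \<comment> \<open>A constant lower bound for \<open>d\<close> on \<open>I\<close> is the form in
    which the estimate passes to the infimum.\<close>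
  have "d c0 / (1 + \<epsilon>) \<le> d c" if c: "c \<in> I" for c
  proof -
    have "d c0 - \<epsilon> / (2 + \<epsilon>) * d c0 \<le> d c + \<epsilon> / (2 + \<epsilon>) * d c"
      using min[OF c] small[OF c] small[OF \<open>c0 \<in> I\<close>] by linarith
    \<comment> \<open>For \<open>\<delta> = \<epsilon> / (2 + \<epsilon>)\<close>, both
      \<open>1 - \<delta> = 2 / (2 + \<epsilon>)\<close> and
      \<open>1 + \<delta> = 2 * (1 + \<epsilon>) / (2 + \<epsilon>)\<close> contain the factor
      \<open>2 / (2 + \<epsilon>)\<close>, which cancels.\<close>
    moreover have "d c0 - \<epsilon> / (2 + \<epsilon>) * d c0 = 2 / (2 + \<epsilon>) * d c0"
      "d c + \<epsilon> / (2 + \<epsilon>) * d c = 2 / (2 + \<epsilon>) * ((1 + \<epsilon>) * d c)"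
      using \<open>\<epsilon> > 0\<close> by (simp_all add: divide_simps algebra_simps)
    ultimately have "d c0 \<le> (1 + \<epsilon>) * d c"
      using \<open>\<epsilon> > 0\<close> by (simp add: divide_le_cancel)
    then show ?thesis
      using \<open>\<epsilon> > 0\<close> by (simp add: field_simps)
  qed
  then have "d c0 / (1 + \<epsilon>) \<le> (INF c\<in>I. d c)"
    using \<open>c0 \<in> I\<close> by (intro cINF_greatest) auto
  then show ?thesis
    using \<open>\<epsilon> > 0\<close> by (simp add: field_simps)
qed

text \<open>If the bias exceeds the variance at \<open>c\<close>, they balance at some \<open>K * c\<close> with \<open>K > 1\<close>; near-optimality of
  \<open>c\<close> and the bias condition give \<open>K powr a \<le> 2 + 2 * \<epsilon>\<close>.\<close>

lemma bias_le_variance_at_near_minimizer: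
  fixes d1 d2 :: "real \<Rightarrow> real"
  assumes "0 < l" "l < u" and c: "c \<in> {l..u}"
    and "a > 0" "b > 0" "B > 0" "\<epsilon> > 0"
    and cont: "continuous_on {l..u} d1" "continuous_on {l..u} d2"
    and d1_nonneg: "\<And>c. c \<in> {l..u} \<Longrightarrow> 0 \<le> d1 c"
    and d2_pos: "\<And>c. c \<in> {l..u} \<Longrightarrow> 0 < d2 c"
    and d2_mono: "\<And>c c'. l \<le> c \<Longrightarrow> c \<le> c' \<Longrightarrow> c' \<le> u \<Longrightarrow> d2 c \<le> d2 c'"
    and right: "d1 u \<le> d2 u"
    and bias: "\<And>c K. c \<in> {l..u} \<Longrightarrow> K > 1 \<Longrightarrow> d1 (K * c) \<le> K powr (- a) * d1 c"
    and variance: "\<And>c k. c \<in> {l..u} \<Longrightarrow> 0 < k \<Longrightarrow> k < 1 \<Longrightarrow> k * c \<in> {l..u} \<Longrightarrow>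
        B * k powr b * d2 c \<le> d2 (k * c)"
    and near: "d1 c + d2 c \<le> (1 + \<epsilon>) * (INF c\<in>{l..u}. d1 c + d2 c)"
  shows "d1 c \<le> inverse B * (2 + 2 * \<epsilon>) powr (1 + b / a) * d2 c"
proof (cases "d1 c \<le> d2 c")
  case True
  \<comment> \<open>What remains is that the constant on the right is at least 1. Comparing
    \<open>d2\<close> at \<open>k * u\<close> and \<open>u\<close> gives
    \<open>B * k powr b \<le> 1\<close>. The choice \<open>k \<ge> 2 powr (- 1 / b)\<close> then
    yields \<open>B \<le> 2\<close>, and \<open>k \<ge> l / u\<close> keeps \<open>k * u\<close> in
    the interval.\<close>
  define k where "k = max (l / u) (2 powr (- 1 / b))"
  have "2 powr (- 1 / b) < (1 :: real)"
    using \<open>b > 0\<close> by (simp add: powr_less_one)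
  then have k: "0 < k" "k < 1" "k * u \<in> {l..u}"
    using \<open>0 < l\<close> \<open>l < u\<close> by (auto simp: k_def max_def field_simps)
  have "B * k powr b * d2 u \<le> 1 * d2 u"
    using variance[of u k] d2_mono[of "k * u" u] k \<open>0 < l\<close> \<open>l < u\<close> by auto
  then have "B * k powr b \<le> 1"
    using d2_pos[of u] \<open>l < u\<close> by (simp add: mult_le_cancel_right)
  moreover have "(2 powr (- 1 / b)) powr b \<le> k powr b"
    using \<open>b > 0\<close> by (intro powr_mono2) (auto simp: k_def)
  moreover have "(2 powr (- 1 / b)) powr b = (1 / 2 :: real)"
    unfolding powr_powr using \<open>b > 0\<close> by (simp add: powr_minus)
  ultimately have "B * (1 / 2) \<le> 1"
    using mult_left_mono[of "1 / 2" "k powr b" B] \<open>B > 0\<close> by linarith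
  moreover have "2 + 2 * \<epsilon> \<le> (2 + 2 * \<epsilon>) powr (1 + b / a)"
    using powr_mono[of 1 "1 + b / a" "2 + 2 * \<epsilon>"] assms(4-7) by simp
  ultimately have "B \<le> (2 + 2 * \<epsilon>) powr (1 + b / a)"
    using \<open>\<epsilon> > 0\<close> by linarith
  then have "1 \<le> inverse B * (2 + 2 * \<epsilon>) powr (1 + b / a)"
    using \<open>B > 0\<close> by (simp add: field_simps)
  then have "1 * d2 c \<le> inverse B * (2 + 2 * \<epsilon>) powr (1 + b / a) * d2 c"
    using d2_pos[OF c] by (intro mult_right_mono) auto
  with True show ?thesis
    by linarith
next
  case False
  \<comment> \<open>The difference \<open>d1 - d2\<close> is positive at \<open>c\<close> and
    nonpositive at \<open>u\<close>.\<close>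
  have "\<exists>c'. c \<le> c' \<and> c' \<le> u \<and> d1 c' - d2 c' = 0"
    using False right c cont
    by (intro IVT2') (auto intro!: continuous_intros elim!: continuous_on_subset)
  then obtain c' where c': "c \<le> c'" "c' \<le> u" "d1 c' = d2 c'"
    by auto
  with False have "c < c'"
    by (cases "c = c'") auto
  define K where "K = c' / c"
  have "c > 0" and c'_mem: "c' \<in> {l..u}"
    using c c' \<open>0 < l\<close> by auto
  then have K: "K > 1" "K * c = c'" "inverse K * c' = c"
    using \<open>c < c'\<close> by (auto simp: K_def)
  have "0 \<le> d1 c + d2 c" if "c \<in> {l..u}" for c
    using d1_nonneg[OF that] d2_pos[OF that] by simp
  then have "(INF c\<in>{l..u}. d1 c + d2 c) \<le> d1 c' + d2 c'"
    using c'_mem by (intro cINF_lower bdd_belowI[of _ 0]) auto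
  then have "(1 + \<epsilon>) * (INF c\<in>{l..u}. d1 c + d2 c) \<le> (1 + \<epsilon>) * (d1 c' + d2 c')"
    using \<open>\<epsilon> > 0\<close> by (intro mult_left_mono) auto
  \<comment> \<open>At \<open>c'\<close> bias and variance coincide, so their sum is
    \<open>2 * d1 c'\<close>; this doubling is the origin of
    \<open>2 + 2 * \<epsilon>\<close>.\<close>
  with near have "d1 c + d2 c \<le> (2 + 2 * \<epsilon>) * d1 c'"
    using c'(3) by (simp add: algebra_simps)
  then have le: "d1 c \<le> (2 + 2 * \<epsilon>) * d1 c'"
    using d2_pos[OF c] by linarith
  also have "\<dots> \<le> (2 + 2 * \<epsilon>) * (K powr (- a) * d1 c)"
    using bias[OF c K(1)] K(2) \<open>\<epsilon> > 0\<close> by (intro mult_left_mono) auto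
  finally have "1 * d1 c \<le> ((2 + 2 * \<epsilon>) * K powr (- a)) * d1 c"
    by simp
  moreover have "d1 c > 0"
    using False d2_pos[OF c] by linarith
  ultimately have "1 \<le> (2 + 2 * \<epsilon>) * K powr (- a)"
    by (simp only: mult_le_cancel_right)
  then have "K powr a \<le> 2 + 2 * \<epsilon>"
    using K by (simp add: powr_minus field_simps)
  then have "(K powr a) powr (b / a) \<le> (2 + 2 * \<epsilon>) powr (b / a)"
    using assms(4-7) by (intro powr_mono2) auto
  then have Kb: "K powr b \<le> (2 + 2 * \<epsilon>) powr (b / a)"
    using \<open>a > 0\<close> by (simp add: powr_powr)
  \<comment> \<open>The variance condition is used at \<open>c'\<close> with
    \<open>k = inverse K\<close>, which leads back to \<open>c\<close> and bounds
    \<open>d2 c'\<close> in terms of \<open>d2 c\<close>.\<close>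
  have "B * inverse K powr b * d2 c' \<le> d2 c"
    using variance[OF c'_mem, of "inverse K"] K c by (simp add: inverse_less_1_iff)
  moreover have "inverse K powr b = inverse (K powr b)" "K powr b > 0"
    using K by (simp_all add: inverse_powr powr_minus)
  ultimately have "d2 c' \<le> inverse B * K powr b * d2 c"
    using \<open>B > 0\<close> by (simp add: field_simps)
  also have "\<dots> \<le> inverse B * (2 + 2 * \<epsilon>) powr (b / a) * d2 c"
    using Kb \<open>B > 0\<close> d2_pos[OF c] by (intro mult_right_mono mult_left_mono) auto
  \<comment> \<open>The extra factor \<open>2 + 2 * \<epsilon>\<close> from near-optimality raises
    the exponent from \<open>b / a\<close> to \<open>1 + b / a\<close>.\<close>
  finally have "(2 + 2 * \<epsilon>) * d1 c' \<le> (2 + 2 * \<epsilon>) * (inverse B * (2 + 2 * \<epsilon>) powr (b / a) * d2 c)"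
    using c'(3) \<open>\<epsilon> > 0\<close> by (intro mult_left_mono) auto
  with le have "d1 c \<le> (2 + 2 * \<epsilon>) * (inverse B * (2 + 2 * \<epsilon>) powr (b / a) * d2 c)"
    by (rule order_trans)
  then show ?thesis
    using \<open>\<epsilon> > 0\<close> by (simp add: powr_add mult_ac)
qed

section \<open>Measurable suprema and convergence in probability\<close>

lemma borel_measurable_cSUP_continuous:
  fixes h :: "real \<Rightarrow> 'w \<Rightarrow> real"
  assumes "l \<le> u"
    and meas: "\<And>c. c \<in> {l..u} \<Longrightarrow> h c \<in> borel_measurable M"
    and cont: "\<And>\<omega>. \<omega> \<in> space M \<Longrightarrow> continuous_on {l..u} (\<lambda>c. h c \<omega>)"
  shows "(\<lambda>\<omega>. SUP c\<in>{l..u}. h c \<omega>) \<in> borel_measurable M"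
proof (rule borel_measurableI_greater)
  fix y :: real
  obtain Q :: "real set" where Q: "countable Q" "\<And>S. open S \<Longrightarrow> S \<noteq> {} \<Longrightarrow> \<exists>q\<in>Q. q \<in> S"
    using countable_dense_exists by blast
  \<comment> \<open>Clamping to \<open>{l..u}\<close> lets a countable dense subset of the whole
    line serve for the interval.\<close>
  define p where "p c = max l (min u c)" for c
  have p: "p c \<in> {l..u}" "c \<in> {l..u} \<Longrightarrow> p c = c" for c
    using \<open>l \<le> u\<close> by (auto simp: p_def)
  \<comment> \<open>By continuity, a value above \<open>y\<close> anywhere forces one at a clamped
    point of \<open>Q\<close>, so the uncountable union becomes a countable one.\<close>
  have "(y < (SUP c\<in>{l..u}. h c \<omega>)) \<longleftrightarrow> (\<exists>q\<in>Q. y < h (p q) \<omega>)" if \<omega>: "\<omega> \<in> space M" for \<omega>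
  proof -
    have "bdd_above ((\<lambda>c. h c \<omega>) ` {l..u})"
      using cont[OF \<omega>] by (intro bounded_imp_bdd_above compact_imp_bounded compact_continuous_image) auto
    then have "(y < (SUP c\<in>{l..u}. h c \<omega>)) \<longleftrightarrow> (\<exists>c\<in>{l..u}. y < h c \<omega>)"
      using \<open>l \<le> u\<close> by (intro less_cSUP_iff) auto
    also have "\<dots> \<longleftrightarrow> (\<exists>c. y < h (p c) \<omega>)"
      using p by metis
    also have "\<dots> \<longleftrightarrow> (\<exists>q\<in>Q. y < h (p q) \<omega>)"
    proof -
      have "continuous_on UNIV (\<lambda>c. h (p c) \<omega>)"
        by (rule continuous_on_compose2[OF cont[OF \<omega>]])
          (use p in \<open>auto simp: p_def[abs_def] intro!: continuous_intros\<close>)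
      then have "open {c. y < h (p c) \<omega>}"
        by (intro open_Collect_less continuous_intros)
      then show ?thesis
        using Q(2)[of "{c. y < h (p c) \<omega>}"] by blast
    qed
    finally show ?thesis .
  qed
  then have "{\<omega> \<in> space M. y < (SUP c\<in>{l..u}. h c \<omega>)} = {\<omega> \<in> space M. \<exists>q\<in>Q. y < h (p q) \<omega>}"
    by auto
  also have "\<dots> \<in> sets M"
    using Q(1) meas[OF p(1)] by measurable
  finally show "{\<omega> \<in> space M. y < (SUP c\<in>{l..u}. h c \<omega>)} \<in> sets M" .
qed

text \<open>The probability of \<open>P n\<close> is squeezed between 1 and one minus the
  probability of \<open>\<bar>V n \<omega>\<bar> > \<delta>\<close>. The index \<open>n0\<close>
  lets degenerate small \<open>n\<close> be left out.\<close>

lemma tendsto_0_in_prob_imp_measure_tendsto_1: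
  assumes V: "tendsto_0_in_prob M V" and "\<delta> > 0"
    and prob: "\<And>n. n \<ge> n0 \<Longrightarrow> prob_space (M n)"
    and meas: "\<And>n. n \<ge> n0 \<Longrightarrow> V n \<in> borel_measurable (M n)"
      "\<And>n. n \<ge> n0 \<Longrightarrow> {\<omega> \<in> space (M n). P n \<omega>} \<in> sets (M n)"
    and imp: "\<And>n \<omega>. n \<ge> n0 \<Longrightarrow> \<omega> \<in> space (M n) \<Longrightarrow> \<bar>V n \<omega>\<bar> \<le> \<delta> \<Longrightarrow> P n \<omega>"
  shows "(\<lambda>n. measure (M n) {\<omega> \<in> space (M n). P n \<omega>}) \<longlonglongrightarrow> 1"
proof (rule tendsto_sandwich)
  show "(\<lambda>n. 1 - measure (M n) {\<omega> \<in> space (M n). \<bar>V n \<omega>\<bar> > \<delta>}) \<longlonglongrightarrow> 1"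
    using tendsto_diff[OF tendsto_const[of 1] V[unfolded tendsto_0_in_prob_def, rule_format, OF \<open>\<delta> > 0\<close>]]
    by simp
  show "\<forall>\<^sub>F n in sequentially. 1 - measure (M n) {\<omega> \<in> space (M n). \<bar>V n \<omega>\<bar> > \<delta>}
      \<le> measure (M n) {\<omega> \<in> space (M n). P n \<omega>}"
    using eventually_ge_at_top[of n0]
  proof eventually_elim
    case (elim n)
    interpret prob_space "M n"
      by (rule prob[OF elim])
    note [measurable] = meas(1)[OF elim]
    have "1 - measure (M n) {\<omega> \<in> space (M n). \<bar>V n \<omega>\<bar> > \<delta>}
        = measure (M n) (space (M n) - {\<omega> \<in> space (M n). \<bar>V n \<omega>\<bar> > \<delta>})"
      by (intro prob_compl[symmetric]) measurable
    also have "\<dots> \<le> measure (M n) {\<omega> \<in> space (M n). P n \<omega>}"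
      using imp[OF elim] by (intro finite_measure_mono meas(2)[OF elim]) (auto simp: not_less)
    finally show ?case .
  qed
  show "\<forall>\<^sub>F n in sequentially. measure (M n) {\<omega> \<in> space (M n). P n \<omega>} \<le> 1"
    using eventually_ge_at_top[of n0] by eventually_elim (use prob prob_space.prob_le_1 in blast)
qed simp

lemma R_borel_measurable:
  assumes [measurable]: "\<And>j. j < n \<Longrightarrow> (\<lambda>\<omega>. Z \<omega> j) \<in> borel_measurable M"
  shows "(\<lambda>\<omega>. R1 kind n lam g (Z \<omega>) c) \<in> borel_measurable M"
    "(\<lambda>\<omega>. R2 kind n lam (Z \<omega>) c) \<in> borel_measurable M"
  by (cases kind; simp; measurable)+

text \<open>The left end is below 1 because \<open>ln n < n\<close>, and the right end is at least 1
  because \<open>m \<ge> 1\<close>. For \<open>n = 1\<close> the left end would be 0.\<close>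

lemma ln_div_bounds:
  assumes "n \<ge> 2" and "m \<ge> 1"
  shows "0 < ln (real n) / real n" "ln (real n) / real n < real n powr (m - 1)"
proof -
  show "0 < ln (real n) / real n"
    using assms by simp
  have "ln (real n) < real n"
    using assms by (intro ln_less_self) simp
  then have "ln (real n) / real n < 1"
    using assms by simp
  also have "1 \<le> real n powr (m - 1)"
    using assms by (intro ge_one_powr_ge_zero) auto
  finally show "ln (real n) / real n < real n powr (m - 1)" .
qed

section \<open>From deterministic bounds to convergence of probabilities\<close>

theorem theorem12:
  fixes X :: "'x set"
    and x :: "nat \<Rightarrow> nat \<Rightarrow> 'x"
    and N :: "'p measure"
    and W :: "'x \<Rightarrow> 'p \<Rightarrow> real"
    and e :: "nat \<Rightarrow> nat \<Rightarrow> real Matrix.vec"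
    and lam :: "nat \<Rightarrow> nat \<Rightarrow> real"
    and M :: "nat \<Rightarrow> 'w measure"
    and eps :: "nat \<Rightarrow> nat \<Rightarrow> 'w \<Rightarrow> real"
    and f :: "'x \<Rightarrow> real"
    and m :: real
    and kind :: eb_kind
    and chat :: "nat \<Rightarrow> 'w \<Rightarrow> real"
  assumes design: "\<And>n i. i < n \<Longrightarrow> x n i \<in> X"
    and prior: "centred_gaussian_process N X W"
    and nonzero: "\<And>n. n \<ge> 1 \<Longrightarrow> cov_matrix N W x n \<noteq> 0\<^sub>m n n"
    and eigen: "\<And>n. n \<ge> 1 \<Longrightarrow> orthonormal_eigenbasis n (cov_matrix N W x n) (e n) (lam n)"
    and noise: "\<And>n. n \<ge> 1 \<Longrightarrow> standard_normal_vector (M n) n (eps n)"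
    and m: "m \<ge> 1"
    and chat_measurable: "\<And>n. n \<ge> 1 \<Longrightarrow> chat n \<in> borel_measurable (M n)"
    and chat_argmin: "\<And>n \<omega>. n \<ge> 1 \<Longrightarrow> \<omega> \<in> space (M n) \<Longrightarrow>
       is_arg_min (criterion kind n (cov_matrix N W x n) (fvec x f n + noise eps n \<omega>))
         (\<lambda>c. c \<in> scale_interval m n) (chat n \<omega>)"
    and remainder: "tendsto_0_in_prob M
       (\<lambda>n \<omega>. SUP c\<in>scale_interval m n.
          (\<bar>R1 kind n (lam n) (coef (fvec x f n) (e n)) (coef (noise eps n \<omega>) (e n)) c\<bar>
            + \<bar>R2 kind n (lam n) (coef (noise eps n \<omega>) (e n)) c\<bar>)
          / D kind n (lam n) (coef (fvec x f n) (e n)) c)"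
  shows "(\<forall>\<epsilon>>0. (\<lambda>n. measure (M n) {\<omega> \<in> space (M n).
             D kind n (lam n) (coef (fvec x f n) (e n)) (chat n \<omega>)
             \<le> (1 + \<epsilon>) * (INF c\<in>scale_interval m n. D kind n (lam n) (coef (fvec x f n) (e n)) c)})
           \<longlonglongrightarrow> 1)
    \<and> (\<forall>a b B B'. a > 0 \<and> b > 0 \<and> B > 0 \<and> B' > 0
         \<and> good_bias (scale_interval m) (\<lambda>n. D1 kind n (lam n) (coef (fvec x f n) (e n))) a
         \<and> good_variance (scale_interval m) (\<lambda>n. D2 kind n (lam n)) b B B'
         \<and> (\<forall>n\<ge>2. (\<Sum>j<n. (coef (fvec x f n) (e n) j)\<^sup>2)
                    \<le> (SUP c\<in>scale_interval m n. D2 kind n (lam n) c))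
       \<longrightarrow> (\<forall>\<epsilon>>0. (\<lambda>n. measure (M n) {\<omega> \<in> space (M n).
             D1 kind n (lam n) (coef (fvec x f n) (e n)) (chat n \<omega>)
             \<le> inverse B * (2 + 2 * \<epsilon>) powr (1 + b / a) * D2 kind n (lam n) (chat n \<omega>)})
           \<longlonglongrightarrow> 1))"
proof -
  define I where "I = scale_interval m"
  define g where "g n = coef (fvec x f n) (e n)" for n
  define Z where "Z n \<omega> = coef (noise eps n \<omega>) (e n)" for n \<omega>
  define R where "R n \<omega> c = R1 kind n (lam n) (g n) (Z n \<omega>) c + R2 kind n (lam n) (Z n \<omega>) c" for n \<omega> c
  define V where "V n \<omega> = (SUP c\<in>I n.
      (\<bar>R1 kind n (lam n) (g n) (Z n \<omega>) c\<bar> + \<bar>R2 kind n (lam n) (Z n \<omega>) c\<bar>)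
      / D kind n (lam n) (g n) c)" for n \<omega>
  have eb: "eigenbasis n (cov_matrix N W x n) (e n) (lam n)" if "n \<ge> 1" for n
    using eigen[OF that] by unfold_locales (auto simp: cov_matrix_def)
  \<comment> \<open>Each eigenvalue is the covariance form at its unit eigenvector.\<close>
  have lam: "lam n j \<ge> 0" if "n \<ge> 1" "j < n" for n j
  proof -
    interpret eigenbasis n "cov_matrix N W x n" "e n" "lam n"
      by (rule eb[OF that(1)])
    show ?thesis
      using cov_matrix_quadratic_form_nonneg[OF prior, of n x "vec_index (e n j)"] design
      by (simp add: lam_eq_quadratic_form[OF that(2)] cov_matrix_def)
  qed
  have I_eq: "I n = {ln (real n) / real n .. real n powr (m - 1)}" for n
    by (simp add: I_def scale_interval_def)
  have I_pos: "c > 0" if "n \<ge> 2" "c \<in> I n" for n c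
    using ln_div_bounds(1)[OF that(1) m] that(2) by (simp add: I_eq)
  \<comment> \<open>A nonzero covariance matrix has a nonzero eigenvalue. Hence \<open>D\<close> is
    positive on \<open>I n\<close>, and the quotient in \<open>V\<close> never falls back on the
    default value 0 of division by 0.\<close>
  have D2_pos: "D2 kind n (lam n) c > 0" if "n \<ge> 2" "c \<in> I n" for n c
  proof -
    interpret eigenbasis n "cov_matrix N W x n" "e n" "lam n"
      using that by (intro eb) simp
    have "1 \<le> n"
      using that by simp
    then obtain j where "j < n" "lam n j \<noteq> 0"
      using ex_lam_nonzero[OF nonzero] by blast
    then show ?thesis
      using that lam[of n] I_pos[OF that] by (intro D2_pos[of n "lam n" c j]) auto
  qed
  have D1_nonneg: "D1 kind n (lam n) (g n) c \<ge> 0" if "n \<ge> 2" "c \<in> I n" for n c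
    using that lam[of n] I_pos[OF that] by (intro D1_nonneg) auto
  have D_pos: "D kind n (lam n) (g n) c > 0" if "n \<ge> 2" "c \<in> I n" for n c
    using D1_nonneg[OF that] D2_pos[OF that] by (simp add: D_def)
  have cont: "continuous_on (I n) (D1 kind n (lam n) (g n))" "continuous_on (I n) (D2 kind n (lam n))"
    "continuous_on (I n) (\<lambda>c. (\<bar>R1 kind n (lam n) (g n) (Z n \<omega>) c\<bar> + \<bar>R2 kind n (lam n) (Z n \<omega>) c\<bar>)
      / D kind n (lam n) (g n) c)" if "n \<ge> 2" for n \<omega>
  proof -
    have "0 \<le> c" if "c \<in> I n" for c
      using I_pos[OF \<open>n \<ge> 2\<close> that] by simp
    note * = continuous_D_R[of n "lam n" "I n", OF lam this]
    show "continuous_on (I n) (D1 kind n (lam n) (g n))" "continuous_on (I n) (D2 kind n (lam n))"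
      using that by (auto intro!: *)
    show "continuous_on (I n) (\<lambda>c. (\<bar>R1 kind n (lam n) (g n) (Z n \<omega>) c\<bar>
        + \<bar>R2 kind n (lam n) (Z n \<omega>) c\<bar>) / D kind n (lam n) (g n) c)"
      using that D_pos[OF that] by (intro continuous_intros *) (auto simp: less_imp_neq[symmetric])
  qed
  have prob: "prob_space (M n)" if "n \<ge> 2" for n
    using noise[of n] that by (simp add: standard_normal_vector_def)
  have Z_meas: "(\<lambda>\<omega>. Z n \<omega> j) \<in> borel_measurable (M n)" if "n \<ge> 2" "j < n" for n j
  proof -
    interpret eigenbasis n "cov_matrix N W x n" "e n" "lam n"
      using that by (intro eb) simp
    have "eps n i \<in> borel_measurable (M n)" if "i < n" for i
      using noise[of n] that \<open>n \<ge> 2\<close> distributed_measurable[of "M n" lborel "eps n i"]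
      by (auto simp: standard_normal_vector_def)
    moreover have "(\<lambda>\<omega>. Z n \<omega> j) = (\<lambda>\<omega>. \<Sum>i<n. eps n i \<omega> * vec_index (e n j) i)"
      using that by (auto simp: Z_def coef_def noise_def scalar_prod_def atLeast0LessThan)
    ultimately show ?thesis
      by simp
  qed
  have V_meas: "V n \<in> borel_measurable (M n)" if "n \<ge> 2" for n
    unfolding V_def[abs_def] I_eq
  proof (rule borel_measurable_cSUP_continuous)
    show "ln (real n) / real n \<le> real n powr (m - 1)"
      using ln_div_bounds(2)[OF that m] by simp
    show "continuous_on {ln (real n) / real n..real n powr (m - 1)}
        (\<lambda>c. (\<bar>R1 kind n (lam n) (g n) (Z n \<omega>) c\<bar> + \<bar>R2 kind n (lam n) (Z n \<omega>) c\<bar>)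
          / D kind n (lam n) (g n) c)" for \<omega>
      using cont(3)[OF that] by (simp add: I_eq)
    show "(\<lambda>\<omega>. (\<bar>R1 kind n (lam n) (g n) (Z n \<omega>) c\<bar> + \<bar>R2 kind n (lam n) (Z n \<omega>) c\<bar>)
          / D kind n (lam n) (g n) c) \<in> borel_measurable (M n)" for c
      using R_borel_measurable[of n "Z n" "M n", OF Z_meas[OF that]] by simp
  qed
  have chat_mem: "chat n \<omega> \<in> I n" if "n \<ge> 2" "\<omega> \<in> space (M n)" for n \<omega>
    using chat_argmin[of n \<omega>] that by (simp add: is_arg_min_def I_def)
  have chat_min: "D kind n (lam n) (g n) (chat n \<omega>) + R n \<omega> (chat n \<omega>)
      \<le> D kind n (lam n) (g n) c + R n \<omega> c"
    if "n \<ge> 2" "\<omega> \<in> space (M n)" "c \<in> I n" for n \<omega> c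
  proof -
    interpret eigenbasis n "cov_matrix N W x n" "e n" "lam n"
      using that by (intro eb) simp
    define y where "y = fvec x f n + noise eps n \<omega>"
    have "criterion kind n (cov_matrix N W x n) y (chat n \<omega>) \<le> criterion kind n (cov_matrix N W x n) y c"
      using chat_argmin[of n \<omega>] that by (auto simp: is_arg_min_linorder I_def y_def)
    \<comment> \<open>The final sum does not depend on \<open>c'\<close> and cancels when two
      criterion values are compared.\<close>
    moreover have "criterion kind n (cov_matrix N W x n) y c' =
        D kind n (lam n) (g n) c' + R n \<omega> c'
        + (\<Sum>j<n. (Z n \<omega> j)\<^sup>2 - (case kind of Risk \<Rightarrow> 1 | Likelihood \<Rightarrow> 0))" if "c' \<in> I n" for c'
    proof -
      have "1 + c' * lam n j > 0" if "j < n" for j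
        using one_plus_pos[of n "lam n" j c'] lam[of n] I_pos[OF _ \<open>c' \<in> I n\<close>] that \<open>n \<ge> 2\<close> by auto
      then show ?thesis
        unfolding y_def
        by (subst criterion_eq) (auto simp: fvec_def noise_def g_def Z_def R_def)
    qed
    ultimately show ?thesis
      using chat_mem that by simp
  qed
  have near: "D kind n (lam n) (g n) (chat n \<omega>) \<le> (1 + \<epsilon>) * (INF c\<in>I n. D kind n (lam n) (g n) c)"
    if n: "n \<ge> 2" and \<omega>: "\<omega> \<in> space (M n)" and V: "\<bar>V n \<omega>\<bar> \<le> \<epsilon> / (2 + \<epsilon>)" and "\<epsilon> > 0" for n \<omega> \<epsilon>
  proof (rule perturbed_argmin_bound[where r = "R n \<omega>" and d = "D kind n (lam n) (g n)",
        OF \<open>\<epsilon> > 0\<close> chat_mem[OF n \<omega>] chat_min[OF n \<omega>]])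
    fix c assume c: "c \<in> I n"
    let ?h = "\<lambda>c. (\<bar>R1 kind n (lam n) (g n) (Z n \<omega>) c\<bar> + \<bar>R2 kind n (lam n) (Z n \<omega>) c\<bar>)
      / D kind n (lam n) (g n) c"
    \<comment> \<open>A real supremum is known to be an upper bound only for a set bounded above;
      compactness and continuity supply this.\<close>
    have "compact (I n)"
      by (simp add: I_eq)
    then have "bdd_above (?h ` I n)"
      using cont(3)[OF n]
      by (intro bounded_imp_bdd_above compact_imp_bounded compact_continuous_image) auto
    then have "?h c \<le> V n \<omega>"
      unfolding V_def by (intro cSUP_upper c)
    also have "\<dots> \<le> \<epsilon> / (2 + \<epsilon>)"
      using V by simp
    finally have "\<bar>R1 kind n (lam n) (g n) (Z n \<omega>) c\<bar> + \<bar>R2 kind n (lam n) (Z n \<omega>) c\<bar>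
        \<le> \<epsilon> / (2 + \<epsilon>) * D kind n (lam n) (g n) c"
      by (subst (asm) pos_divide_le_eq[OF D_pos[OF n c]])
    then show "\<bar>R n \<omega> c\<bar> \<le> \<epsilon> / (2 + \<epsilon>) * D kind n (lam n) (g n) c"
      unfolding R_def by (rule order_trans[OF abs_triangle_ineq])
  qed
  have V_tendsto: "tendsto_0_in_prob M V"
    using remainder by (simp add: V_def[abs_def] I_def g_def Z_def)
  \<comment> \<open>Left to each of the two claims: \<open>\<delta>\<close>, the starting index,
    measurability of the event, and its validity where
    \<open>\<bar>V n \<omega>\<bar> \<le> \<delta>\<close>.\<close>
  note tendsto_1 = tendsto_0_in_prob_imp_measure_tendsto_1[OF V_tendsto _ prob V_meas]
  have chat_meas: "chat n \<in> borel_measurable (M n)" if "n \<ge> 2" for n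
    using chat_measurable[of n] that by simp
  have "(\<lambda>n. measure (M n) {\<omega> \<in> space (M n). D kind n (lam n) (g n) (chat n \<omega>)
      \<le> (1 + \<epsilon>) * (INF c\<in>I n. D kind n (lam n) (g n) c)}) \<longlonglongrightarrow> 1" if "\<epsilon> > 0" for \<epsilon>
  proof (rule tendsto_1[of "\<epsilon> / (2 + \<epsilon>)" 2])
    fix n :: nat assume n: "2 \<le> n"
    note [measurable] = chat_meas[OF n]
    show "{\<omega> \<in> space (M n). D kind n (lam n) (g n) (chat n \<omega>)
        \<le> (1 + \<epsilon>) * (INF c\<in>I n. D kind n (lam n) (g n) c)} \<in> sets (M n)"
      by measurable
  qed (use that near in auto)
  moreover have "(\<lambda>n. measure (M n) {\<omega> \<in> space (M n). D1 kind n (lam n) (g n) (chat n \<omega>)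
      \<le> inverse B * (2 + 2 * \<epsilon>) powr (1 + b / a) * D2 kind n (lam n) (chat n \<omega>)}) \<longlonglongrightarrow> 1"
    if pos: "a > 0" "b > 0" "B > 0"
      and bias: "good_bias I (\<lambda>n. D1 kind n (lam n) (g n)) a"
      and variance: "good_variance I (\<lambda>n. D2 kind n (lam n)) b B B'"
      and energy: "\<forall>n\<ge>2. (\<Sum>j<n. (g n j)\<^sup>2) \<le> (SUP c\<in>I n. D2 kind n (lam n) c)"
      and "\<epsilon> > 0" for a b B B' \<epsilon>
  proof (rule tendsto_1[of "\<epsilon> / (2 + \<epsilon>)" 2])
    fix n :: nat assume n: "2 \<le> n"
    show "{\<omega> \<in> space (M n). D1 kind n (lam n) (g n) (chat n \<omega>)
        \<le> inverse B * (2 + 2 * \<epsilon>) powr (1 + b / a) * D2 kind n (lam n) (chat n \<omega>)} \<in> sets (M n)"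
      by (intro borel_measurable_le borel_measurable_times borel_measurable_const
          measurable_compose[OF chat_meas[OF n]] D_borel_measurable)
    fix \<omega> assume \<omega>: "\<omega> \<in> space (M n)" and V: "\<bar>V n \<omega>\<bar> \<le> \<epsilon> / (2 + \<epsilon>)"
    let ?l = "ln (real n) / real n" and ?u = "real n powr (m - 1)"
    note lu = ln_div_bounds[OF n m]
    have mono: "D2 kind n (lam n) c \<le> D2 kind n (lam n) c'" if "?l \<le> c" "c \<le> c'" for c c'
    proof (rule D2_mono)
      show "0 \<le> c"
        using lu(1) that(1) by linarith
    qed (use that lam[of n] n in auto)
    \<comment> \<open>The condition on the sum of squares enters here: it makes the variance
      dominate the bias at the right end, so that a balance point exists inside the
      interval.\<close>
    have "D1 kind n (lam n) (g n) ?u \<le> (\<Sum>j<n. (g n j)\<^sup>2)"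
      using lam[of n] n by (intro D1_le_sum_squares) auto
    also have "\<dots> \<le> (SUP c\<in>I n. D2 kind n (lam n) c)"
      using energy n by simp
    also have "\<dots> \<le> D2 kind n (lam n) ?u"
      using lu by (intro cSUP_least) (auto simp: I_eq intro!: mono)
    finally have right: "D1 kind n (lam n) (g n) ?u \<le> D2 kind n (lam n) ?u" .
    show "D1 kind n (lam n) (g n) (chat n \<omega>)
        \<le> inverse B * (2 + 2 * \<epsilon>) powr (1 + b / a) * D2 kind n (lam n) (chat n \<omega>)"
    proof (rule bias_le_variance_at_near_minimizer[where ?d1.0 = "D1 kind n (lam n) (g n)"
          and ?d2.0 = "D2 kind n (lam n)", OF lu _ pos \<open>\<epsilon> > 0\<close> _ _ _ _ mono right, folded I_eq])
      show "D1 kind n (lam n) (g n) (chat n \<omega>) + D2 kind n (lam n) (chat n \<omega>)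
          \<le> (1 + \<epsilon>) * (INF c\<in>I n. D1 kind n (lam n) (g n) c + D2 kind n (lam n) c)"
        using near[OF n \<omega> V \<open>\<epsilon> > 0\<close>] by (simp add: D_def)
    qed (use n \<omega> chat_mem cont D1_nonneg D2_pos bias variance in
        \<open>auto simp: good_bias_def good_variance_def\<close>)
  qed (use that in auto)
  ultimately show ?thesis
    unfolding I_def g_def by blast
qed

end
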